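(* Let $\{\mathbf{u}^n\}_{n\in\mathbb{N}}$ be a sequence of the outputs produced in the BDF-2 accelerated gradient flow algorithm described in the context. (a) (Energy decay) For every $n\ge3$, $$\mathcal{G}_{\mathcal{M}}(\mathbf{u}^n,\mathbf{u}^{n-1})+\|\dot{\mathbf{u}}^n\|_U^2\le\mathcal{G}_{\mathcal{M}}(\mathbf{u}^{n-1},\mathbf{u}^{n-2})+\|\dot{\mathbf{u}}^{n-1}\|_U^2 .$$ (b) (Termination in finite steps) For every given $s>0$ and $\varepsilon>0$, the algorithm terminates in a finite number of iterations.
   Context: Setting. $\Omega\subset\mathbb{R}^d$ is a bounded Lipschitz domain; $U$ is a real Hilbert space of functions $\Omega\to\mathbb{R}^m$ continuously embedded in $H^1(\Omega;\mathbb{R}^m)$; $U_D\subset U$ is the set of functions satisfying given Dirichlet conditions on $\Gamma_D\subset\partial\Omega$ and $U_0\subset U$ is the linear subspace of functions satisfying the corresponding homogeneous conditions. $Z$ is a normed function space on $\Omega$, $B:U\times U\to Z$ is symmetric bilinear with $\|B(\mathbf{v},\mathbf{v})\|_Z\le c_Z\|\mathbf{v}\|_U^2$, and $\mathbf{u}_c\in Z$. $\mathcal{M}:U\times U\to\mathbb{R}$ is symmetric bilinear with $\mathcal{M}(\mathbf{v},\mathbf{v})\ge C_1\|\mathbf{v}\|_U^2$ and $\mathcal{M}(\mathbf{v},\mathbf{w})\le C_2\|\mathbf{v}\|_U\|\mathbf{w}\|_U$ on $U$ ($C_1,C_2>0$). $\mathcal{A}=\{\mathbf{u}\in U_D:B(\mathbf{u},\mathbf{u})=\mathbf{u}_c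 \text{ a.e. in }\Omega\}$ and $\mathcal{F}_{\mathbf{u}}=\{\mathbf{v}\in U_0:B(\mathbf{u},\mathbf{v})=0\text{ a.e. in }\Omega\}$. $\mathcal{G}_{\mathcal{M}}(\mathbf{u},\mathbf{v})=\frac52\mathcal{M}(\mathbf{u},\mathbf{u})-2\mathcal{M}(\mathbf{u},\mathbf{v})+\frac12\mathcal{M}(\mathbf{v},\mathbf{v})$. For a sequence $(a_n)$, $d_ta_n=(a_n-a_{n-1})/s$. Algorithm (BDF-2 accelerated flow). Input: $\mathbf{u}^0\in\mathcal{A}$, $s>0$, $d_t\mathbf{u}^0=\mathbf{0}$, $\alpha\ge3$, $\varepsilon>0$ and a sufficiently large $T_{max}>0$; put $t_n=ns$. Step 1: with $d_t^2\mathbf{u}^1=(d_t\mathbf{u}^1-d_t\mathbf{u}^0)/s$, find $d_t\mathbf{u}^1\in\mathcal{F}_{\mathbf{u}^0}$ with $(d_t^2\mathbf{u}^1,\mathbf{w})_U+\frac{\alpha}{s}(d_t\mathbf{u}^1,\mathbf{w})_U+\mathcal{M}(\mathbf{u}^0+s\,d_t\mathbf{u}^1,\mathbf{w})=0$ for all $\mathbf{w}\in\mathcal{F}_{\mathbf{u}^0}$; set $\mathbf{u}^1=\mathbf{u}^0+s\,d_t\mathbf{u}^1$. Step 2: with $\hat{\mathbf{u}}^2=2\mathbf{u}^1-\mathbf{u}^0$, find $\dot{\mathbf{u}}^2\in\mathcal{F}_{\hat{\mathbf{u}}^2}$ with $(\frac{\dot{\mathbf{u}}^2-d_t\mathbf{u}^1}{s},\mathbf{w})_U+\frac{\alpha}{2s}(\dot{\mathbf{u}}^2,\mathbf{w})_U+\frac13\mathcal{M}(4\mathbf{u}^1-\mathbf{u}^0+2s\dot{\mathbf{u}}^2,\mathbf{w})=0$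 for all $\mathbf{w}\in\mathcal{F}_{\hat{\mathbf{u}}^2}$; set $\mathbf{u}^2=(4\mathbf{u}^1-\mathbf{u}^0+2s\dot{\mathbf{u}}^2)/3$. Step $n\ge3$: with $\hat{\mathbf{u}}^n=2\mathbf{u}^{n-1}-\mathbf{u}^{n-2}$, find $\dot{\mathbf{u}}^n\in\mathcal{F}_{\hat{\mathbf{u}}^n}$ with $(\frac{\dot{\mathbf{u}}^n-\dot{\mathbf{u}}^{n-1}}{s},\mathbf{w})_U+\frac{\alpha}{t_n}(\dot{\mathbf{u}}^n,\mathbf{w})_U+\frac13\mathcal{M}(4\mathbf{u}^{n-1}-\mathbf{u}^{n-2}+2s\dot{\mathbf{u}}^n,\mathbf{w})=0$ for all $\mathbf{w}\in\mathcal{F}_{\hat{\mathbf{u}}^n}$; set $\mathbf{u}^n=(4\mathbf{u}^{n-1}-\mathbf{u}^{n-2}+2s\dot{\mathbf{u}}^n)/3$ (so $\dot{\mathbf{u}}^n=(3\mathbf{u}^n-4\mathbf{u}^{n-1}+\mathbf{u}^{n-2})/(2s)$). Stopping rule (checked at each step $n\ge3$): stop and output $\mathbf{u}^n$ when $$\Big|\tfrac12 d_t\big(\mathcal{G}_{\mathcal{M}}(\mathbf{u}^n,\mathbf{u}^{n-1})+\|\dot{\mathbf{u}}^n\|_U^2\big)\Big|\le\varepsilon\quad\text{or}\quad n>[T_{max}/s];$$ otherwise increase $n$ by one and continue. *)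

theory Defs
  imports "HOL-Analysis.Analysis"
begin

section \<open>Bounded Lipschitz domains\<close>

text \<open>
  Near each boundary point \<open>p\<close> the domain is, after a rigid motion, the part of a ball above the
  graph of a Lipschitz function.  The unit vector \<open>\<nu>\<close> is the vertical direction of the local
  coordinates centred at \<open>p\<close>; \<open>\<gamma>\<close> is only evaluated on the hyperplane orthogonal to \<open>\<nu>\<close>.
\<close>

definition bounded_lipschitz_domain :: "(real^'d) set \<Rightarrow> bool" where
  "bounded_lipschitz_domain \<Omega> \<longleftrightarrow>
     open \<Omega> \<and> connected \<Omega> \<and> \<Omega> \<noteq> {} \<and> bounded \<Omega> \<and>
     (\<forall>p\<in>frontier \<Omega>. \<exists>\<nu> r L \<gamma>. norm \<nu> = 1 \<and> r > 0 \<and> L-lipschitz_on UNIV (\<gamma> :: real^'d \<Rightarrow> real) \<and>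
        \<Omega> \<inter> ball p r =
          {x \<in> ball p r. (x - p) \<bullet> \<nu> > \<gamma> ((x - p) - ((x - p) \<bullet> \<nu>) *\<^sub>R \<nu>)})"

section \<open>The Sobolev space $H^1$\<close>

definition pderiv_at :: "'d \<Rightarrow> (real^'d \<Rightarrow> real) \<Rightarrow> real^'d \<Rightarrow> real" where
  "pderiv_at i f x = frechet_derivative f (at x) (axis i 1)"

primrec C_k :: "nat \<Rightarrow> (real^'d \<Rightarrow> real) \<Rightarrow> bool" where
  "C_k 0 f \<longleftrightarrow> continuous_on UNIV f"
| "C_k (Suc k) f \<longleftrightarrow> (\<forall>x. f differentiable (at x)) \<and> (\<forall>i. C_k k (pderiv_at i f))"

definition test_function :: "(real^'d) set \<Rightarrow> (real^'d \<Rightarrow> real) \<Rightarrow> bool" where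
  "test_function \<Omega> \<phi> \<longleftrightarrow> (\<forall>k. C_k k \<phi>) \<and>
     compact (closure {x. \<phi> x \<noteq> 0}) \<and> closure {x. \<phi> x \<noteq> 0} \<subseteq> \<Omega>"

definition L2 :: "(real^'d) set \<Rightarrow> (real^'d \<Rightarrow> 'b::euclidean_space) \<Rightarrow> bool" where
  "L2 \<Omega> f \<longleftrightarrow> f \<in> borel_measurable (lebesgue_on \<Omega>) \<and>
     integrable (lebesgue_on \<Omega>) (\<lambda>x. (norm (f x))\<^sup>2)"

definition is_weak_pderiv ::
  "(real^'d) set \<Rightarrow> 'd \<Rightarrow> (real^'d \<Rightarrow> real^'m) \<Rightarrow> (real^'d \<Rightarrow> real^'m) \<Rightarrow> bool" where
  "is_weak_pderiv \<Omega> i f g \<longleftrightarrow>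
     (\<forall>\<phi>. test_function \<Omega> \<phi> \<longrightarrow>
        (LINT x|lebesgue_on \<Omega>. pderiv_at i \<phi> x *\<^sub>R f x) = - (LINT x|lebesgue_on \<Omega>. \<phi> x *\<^sub>R g x))"

definition H1 :: "(real^'d) set \<Rightarrow> (real^'d \<Rightarrow> real^'m) \<Rightarrow> bool" where
  "H1 \<Omega> f \<longleftrightarrow> L2 \<Omega> f \<and> (\<forall>i. \<exists>g. L2 \<Omega> g \<and> is_weak_pderiv \<Omega> i f g)"

text \<open>Weak derivatives are unique almost everywhere, so the choice below does not affect the norm.\<close>

definition weak_pderiv ::
  "(real^'d) set \<Rightarrow> 'd \<Rightarrow> (real^'d \<Rightarrow> real^'m) \<Rightarrow> (real^'d \<Rightarrow> real^'m)" where
  "weak_pderiv \<Omega> i f = (SOME g. L2 \<Omega> g \<and> is_weak_pderiv \<Omega> i f g)"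

definition H1_norm :: "(real^'d) set \<Rightarrow> (real^'d \<Rightarrow> real^'m) \<Rightarrow> real" where
  "H1_norm \<Omega> f = sqrt ((LINT x|lebesgue_on \<Omega>. (norm (f x))\<^sup>2) +
     (\<Sum>i\<in>UNIV. LINT x|lebesgue_on \<Omega>. (norm (weak_pderiv \<Omega> i f x))\<^sup>2))"

section \<open>Function spaces on a domain\<close>

text \<open>
  A space of (almost everywhere equivalence classes of) functions on \<open>\<Omega>\<close> is a type together with
  a map \<open>J\<close> that picks, for each element, a function representing it.  The algebraic operations
  are the pointwise ones and equality is equality almost everywhere.
\<close>

definition linear_ae :: "(real^'d) set \<Rightarrow> ('v::real_vector \<Rightarrow> real^'d \<Rightarrow> 'b::real_vector) \<Rightarrow> bool" where
  "linear_ae \<Omega> J \<longleftrightarrow>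
     (\<forall>v w. AE x in lebesgue_on \<Omega>. J (v + w) x = J v x + J w x) \<and>
     (\<forall>c v. AE x in lebesgue_on \<Omega>. J (c *\<^sub>R v) x = c *\<^sub>R J v x)"

definition function_space_on ::
  "(real^'d) set \<Rightarrow> ('v::real_vector \<Rightarrow> real^'d \<Rightarrow> 'b::real_vector) \<Rightarrow> bool" where
  "function_space_on \<Omega> J \<longleftrightarrow>
     linear_ae \<Omega> J \<and> (\<forall>v. (AE x in lebesgue_on \<Omega>. J v x = 0) \<longrightarrow> v = 0)"

definition continuously_embedded_H1 ::
  "(real^'d) set \<Rightarrow> ('u::real_normed_vector \<Rightarrow> real^'d \<Rightarrow> real^'m) \<Rightarrow> bool" where
  "continuously_embedded_H1 \<Omega> J \<longleftrightarrow>
     (\<forall>v. H1 \<Omega> (J v)) \<and> (\<exists>C. \<forall>v. H1_norm \<Omega> (J v) \<le> C * norm v)"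

section \<open>Dirichlet conditions\<close>

text \<open>
  The null sets of the surface measure, that is, of the $(d-1)$-dimensional Hausdorff measure.
\<close>

definition surface_null :: "(real^'d) set \<Rightarrow> bool" where
  "surface_null N \<longleftrightarrow>
     (\<forall>\<epsilon>>0. \<exists>C :: nat \<Rightarrow> (real^'d) set. (\<forall>k. bounded (C k)) \<and> N \<subseteq> (\<Union>k. C k) \<and>
        summable (\<lambda>k. if C k = {} then 0 else diameter (C k) ^ (CARD('d) - 1)) \<and>
        (\<Sum>k. if C k = {} then 0 else diameter (C k) ^ (CARD('d) - 1)) \<le> \<epsilon>)"

text \<open>
  \<open>f\<close> has the trace \<open>b\<close> at the boundary point \<open>x\<close> if the mean of $|f - b|$ over
  $\Omega \cap B_r(x)$ tends to 0 as $r \to 0$.  For a Sobolev function on a bounded Lipschitz domain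
  this is satisfied by its trace at almost every boundary point (Evans and Gariepy,
  Measure Theory and Fine Properties of Functions, Section 5.3).
\<close>

definition has_trace_at ::
  "(real^'d) set \<Rightarrow> (real^'d \<Rightarrow> 'b::euclidean_space) \<Rightarrow> real^'d \<Rightarrow> 'b \<Rightarrow> bool" where
  "has_trace_at \<Omega> f x b \<longleftrightarrow>
     ((\<lambda>r. (LINT y|lebesgue_on (\<Omega> \<inter> ball x r). norm (f y - b)) / measure lebesgue (\<Omega> \<inter> ball x r))
        \<longlongrightarrow> 0) (at_right 0)"

text \<open>
  The elements \<open>v\<close> whose Dirichlet quantity \<open>D v\<close> has the boundary values \<open>g\<close> almost everywhere
  on \<open>\<Gamma>\<^sub>D\<close>.  For the plain condition $v = g$ the quantity \<open>D v\<close> is the function \<open>v\<close> itself; a clamped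
  condition, in a space \<open>U\<close> inside $H^2$, has the pair of \<open>v\<close> and its gradient as \<open>D v\<close>, and a
  condition on some components only has those components.
\<close>

definition dirichlet_set ::
  "(real^'d) set \<Rightarrow> (real^'d) set \<Rightarrow> ('u \<Rightarrow> real^'d \<Rightarrow> 'b::euclidean_space) \<Rightarrow> (real^'d \<Rightarrow> 'b) \<Rightarrow> 'u set"
where
  "dirichlet_set \<Omega> \<Gamma>\<^sub>D D g = {v. surface_null {x \<in> \<Gamma>\<^sub>D. \<not> has_trace_at \<Omega> (D v) x (g x)}}"

section \<open>The constraint\<close>

definition admissible_set ::
  "(real^'d) set \<Rightarrow> ('z \<Rightarrow> real^'d \<Rightarrow> 'e) \<Rightarrow> ('u \<Rightarrow> 'u \<Rightarrow> 'z) \<Rightarrow> 'z \<Rightarrow> 'u set \<Rightarrow> 'u set" where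
  "admissible_set \<Omega> \<zeta> B u\<^sub>c U\<^sub>D = {u \<in> U\<^sub>D. AE x in lebesgue_on \<Omega>. \<zeta> (B u u) x = \<zeta> u\<^sub>c x}"

definition tangent_space ::
  "(real^'d) set \<Rightarrow> ('z \<Rightarrow> real^'d \<Rightarrow> 'e::zero) \<Rightarrow> ('u \<Rightarrow> 'u \<Rightarrow> 'z) \<Rightarrow> 'u set \<Rightarrow> 'u \<Rightarrow> 'u set" where
  "tangent_space \<Omega> \<zeta> B U\<^sub>0 u = {v \<in> U\<^sub>0. AE x in lebesgue_on \<Omega>. \<zeta> (B u v) x = 0}"

section \<open>The BDF-2 accelerated flow\<close>

text \<open>The argument \<open>F\<close> below is the map $u \mapsto \mathcal F_u$, and \<open>du n\<close> is $\dot u^n$ for $n \ge 2$.\<close>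

definition d_t :: "real \<Rightarrow> (nat \<Rightarrow> 'v::real_vector) \<Rightarrow> nat \<Rightarrow> 'v" where
  "d_t s a n = (a n - a (n - 1)) /\<^sub>R s"

text \<open>
  The input $d_t u^0 = 0$ of the scheme enters as the \<open>0\<close> subtracted in $d_t^2 u^1$.
\<close>

definition bdf2_step1 ::
  "('u \<Rightarrow> 'u set) \<Rightarrow> ('u \<Rightarrow> 'u \<Rightarrow> real) \<Rightarrow> real \<Rightarrow> real \<Rightarrow> (nat \<Rightarrow> 'u::real_inner) \<Rightarrow> bool" where
  "bdf2_step1 F M \<alpha> s u \<longleftrightarrow>
     d_t s u 1 \<in> F (u 0) \<and>
     (\<forall>w\<in>F (u 0). ((d_t s u 1 - 0) /\<^sub>R s) \<bullet> w + \<alpha> / s * (d_t s u 1 \<bullet> w)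
        + M (u 0 + s *\<^sub>R d_t s u 1) w = 0)"

definition bdf2_step2 ::
  "('u \<Rightarrow> 'u set) \<Rightarrow> ('u \<Rightarrow> 'u \<Rightarrow> real) \<Rightarrow> real \<Rightarrow> real \<Rightarrow> (nat \<Rightarrow> 'u::real_inner) \<Rightarrow> (nat \<Rightarrow> 'u) \<Rightarrow> bool"
where
  "bdf2_step2 F M \<alpha> s u du \<longleftrightarrow>
     (let u_hat = 2 *\<^sub>R u 1 - u 0 in
       du 2 \<in> F u_hat \<and>
       (\<forall>w\<in>F u_hat. ((du 2 - d_t s u 1) /\<^sub>R s) \<bullet> w + \<alpha> / (2 * s) * (du 2 \<bullet> w)
          + 1 / 3 * M (4 *\<^sub>R u 1 - u 0 + (2 * s) *\<^sub>R du 2) w = 0) \<and>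
       u 2 = (4 *\<^sub>R u 1 - u 0 + (2 * s) *\<^sub>R du 2) /\<^sub>R 3)"

definition bdf2_step ::
  "('u \<Rightarrow> 'u set) \<Rightarrow> ('u \<Rightarrow> 'u \<Rightarrow> real) \<Rightarrow> real \<Rightarrow> real \<Rightarrow> (nat \<Rightarrow> 'u::real_inner) \<Rightarrow> (nat \<Rightarrow> 'u) \<Rightarrow>
   nat \<Rightarrow> bool" where
  "bdf2_step F M \<alpha> s u du n \<longleftrightarrow>
     (let u_hat = 2 *\<^sub>R u (n - 1) - u (n - 2); t\<^sub>n = real n * s in
       du n \<in> F u_hat \<and>
       (\<forall>w\<in>F u_hat. ((du n - du (n - 1)) /\<^sub>R s) \<bullet> w + \<alpha> / t\<^sub>n * (du n \<bullet> w)
          + 1 / 3 * M (4 *\<^sub>R u (n - 1) - u (n - 2) + (2 * s) *\<^sub>R du n) w = 0) \<and>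
       u n = (4 *\<^sub>R u (n - 1) - u (n - 2) + (2 * s) *\<^sub>R du n) /\<^sub>R 3)"

text \<open>The first \<open>N\<close> iterates are produced by the scheme; \<open>A\<close> is the set of admissible inputs.\<close>

definition bdf2_iterates ::
  "'u set \<Rightarrow> ('u \<Rightarrow> 'u set) \<Rightarrow> ('u \<Rightarrow> 'u \<Rightarrow> real) \<Rightarrow> real \<Rightarrow> real \<Rightarrow> (nat \<Rightarrow> 'u::real_inner) \<Rightarrow>
   (nat \<Rightarrow> 'u) \<Rightarrow> nat \<Rightarrow> bool" where
  "bdf2_iterates A F M \<alpha> s u du N \<longleftrightarrow>
     u 0 \<in> A \<and>
     (1 \<le> N \<longrightarrow> bdf2_step1 F M \<alpha> s u) \<and>
     (2 \<le> N \<longrightarrow> bdf2_step2 F M \<alpha> s u du) \<and>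
     (\<forall>n\<in>{3..N}. bdf2_step F M \<alpha> s u du n)"

definition G_M :: "('u \<Rightarrow> 'u \<Rightarrow> real) \<Rightarrow> 'u \<Rightarrow> 'u \<Rightarrow> real" where
  "G_M M u v = 5 / 2 * M u u - 2 * M u v + 1 / 2 * M v v"

definition bdf2_energy ::
  "('u \<Rightarrow> 'u \<Rightarrow> real) \<Rightarrow> (nat \<Rightarrow> 'u::real_normed_vector) \<Rightarrow> (nat \<Rightarrow> 'u) \<Rightarrow> nat \<Rightarrow> real" where
  "bdf2_energy M u du n = G_M M (u n) (u (n - 1)) + (norm (du n))\<^sup>2"

definition energy_stop ::
  "('u \<Rightarrow> 'u \<Rightarrow> real) \<Rightarrow> real \<Rightarrow> real \<Rightarrow> (nat \<Rightarrow> 'u::real_normed_vector) \<Rightarrow> (nat \<Rightarrow> 'u) \<Rightarrow> nat \<Rightarrow> bool" where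
  "energy_stop M s \<epsilon> u du n \<longleftrightarrow> \<bar>1 / 2 * d_t s (bdf2_energy M u du) n\<bar> \<le> \<epsilon>"

definition bdf2_stop ::
  "('u \<Rightarrow> 'u \<Rightarrow> real) \<Rightarrow> real \<Rightarrow> real \<Rightarrow> real \<Rightarrow> (nat \<Rightarrow> 'u::real_normed_vector) \<Rightarrow> (nat \<Rightarrow> 'u) \<Rightarrow> nat \<Rightarrow> bool"
where
  "bdf2_stop M s \<epsilon> T_max u du n \<longleftrightarrow> energy_stop M s \<epsilon> u du n \<or> int n > \<lfloor>T_max / s\<rfloor>"

text \<open>
  A run of the algorithm under the stopping rule \<open>stop\<close>, which is checked from step 3 on: step \<open>N\<close> is
  carried out as long as no earlier step has stopped.  The values of \<open>u\<close> and \<open>du\<close> beyond the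
  stopping index are arbitrary.
\<close>

definition bdf2_run ::
  "(nat \<Rightarrow> bool) \<Rightarrow> 'u set \<Rightarrow> ('u \<Rightarrow> 'u set) \<Rightarrow> ('u \<Rightarrow> 'u \<Rightarrow> real) \<Rightarrow> real \<Rightarrow> real \<Rightarrow>
   (nat \<Rightarrow> 'u::real_inner) \<Rightarrow> (nat \<Rightarrow> 'u) \<Rightarrow> bool" where
  "bdf2_run stop A F M \<alpha> s u du \<longleftrightarrow>
     (\<forall>N. (\<forall>k\<in>{3..<N}. \<not> stop k) \<longrightarrow> bdf2_iterates A F M \<alpha> s u du N)"

definition terminates_at :: "(nat \<Rightarrow> bool) \<Rightarrow> nat \<Rightarrow> bool" where
  "terminates_at stop n \<longleftrightarrow> 3 \<le> n \<and> stop n \<and> (\<forall>k\<in>{3..<n}. \<not> stop k)"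

end

theory Submission
  imports Defs
begin

text \<open>
  Testing step \<open>n\<close> with $w = \dot u^n$ and multiplying by $2s$ turns each term into a difference of
  squares plus a square: $2(\dot u^n - \dot u^{n-1}) \cdot \dot u^n = |\dot u^n|^2 - |\dot u^{n-1}|^2
  + |\dot u^n - \dot u^{n-1}|^2$, and, with $2s\dot u^n = 3u^n - 4u^{n-1} + u^{n-2}$,
  $2s\,\mathcal M(u^n, \dot u^n) = \mathcal G(u^n,u^{n-1}) - \mathcal G(u^{n-1},u^{n-2})
  + \frac12 \mathcal M(\delta, \delta)$ where $\delta = u^n - 2u^{n-1} + u^{n-2}$.  Hence the energy
  decreases.  As it is nonnegative, it cannot drop by more than $2s\varepsilon$ at every step.
\<close>

text \<open>Completing the square with the extrapolation \<open>2 *\<^sub>R a - b\<close>; this is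
  the G-norm from Dahlquist's stability theory for BDF-2. It bounds the energy from below.\<close>

lemma G_M_nonneg:
  assumes "bilinear M" "\<And>v w. M v w = M w v" "\<And>v. M v v \<ge> 0"
  shows "G_M M a b \<ge> 0"
proof -
  have "2 * G_M M a b = M a a + M (2 *\<^sub>R a - b) (2 *\<^sub>R a - b)"
    using assms(2)[of a b]
    by (simp add: G_M_def bilinear_lsub[OF assms(1)] bilinear_rsub[OF assms(1)]
        bilinear_lmul[OF assms(1)] bilinear_rmul[OF assms(1)])
  with assms(3)[of a] assms(3)[of "2 *\<^sub>R a - b"] show ?thesis
    by linarith
qed

text \<open>G-stability of BDF-2: for consecutive iterates the second argument is
  \<open>2 * s\<close> times the discrete velocity. Both sides are quadratic forms in
  \<open>a\<close>, \<open>b\<close>, \<open>c\<close> with equal coefficients.\<close>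

lemma G_M_identity:
  assumes "bilinear M" "\<And>v w. M v w = M w v"
  shows "M a (3 *\<^sub>R a - 4 *\<^sub>R b + c) =
    G_M M a b - G_M M b c + 1 / 2 * M (a - 2 *\<^sub>R b + c) (a - 2 *\<^sub>R b + c)"
  using assms(2)[of a b] assms(2)[of a c] assms(2)[of b c]
  by (simp add: G_M_def bilinear_lsub[OF assms(1)] bilinear_rsub[OF assms(1)]
      bilinear_ladd[OF assms(1)] bilinear_radd[OF assms(1)]
      bilinear_lmul[OF assms(1)] bilinear_rmul[OF assms(1)] field_simps)

lemma bdf2_step_energy_decay:
  assumes M: "bilinear M" "\<And>v w. M v w = M w v" "\<And>v. M v v \<ge> 0"
    and s: "s > 0" and \<alpha>: "\<alpha> \<ge> 0"
    and step: "bdf2_step F M \<alpha> s u du n"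
  shows "bdf2_energy M u du n \<le> bdf2_energy M u du (n - 1)"
proof -
  define a b c p q where "a = u n" and "b = u (n - 1)" and "c = u (n - 2)"
    and "p = du n" and "q = du (n - 1)"
  \<comment> \<open>The argument of \<open>M\<close> in the scheme is three times the new iterate,
    which absorbs the factor 1/3 below.\<close>
  have a: "3 *\<^sub>R a = 4 *\<^sub>R b - c + (2 * s) *\<^sub>R p"
    using step by (simp add: bdf2_step_def Let_def a_def b_def c_def p_def)
  then have p: "(2 * s) *\<^sub>R p = 3 *\<^sub>R a - 4 *\<^sub>R b + c"
    by simp
  \<comment> \<open>\<open>p\<close> is an admissible test vector, as the step itself places it in
    \<open>F\<close> at the extrapolated point.\<close>
  have "((p - q) /\<^sub>R s) \<bullet> p + \<alpha> / (real n * s) * (p \<bullet> p)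
      + 1 / 3 * M (4 *\<^sub>R b - c + (2 * s) *\<^sub>R p) p = 0"
    using step by (simp add: bdf2_step_def Let_def b_def c_def p_def q_def)
  then have "(p - q) \<bullet> p / s + \<alpha> / (real n * s) * (p \<bullet> p) + M a p = 0"
    unfolding a[symmetric] by (simp add: bilinear_lmul[OF M(1)] inverse_eq_divide)
  then have "2 * s * ((p - q) \<bullet> p / s + \<alpha> / (real n * s) * (p \<bullet> p) + M a p) = 0"
    by simp
  then have "2 * ((p - q) \<bullet> p) + 2 * (\<alpha> / real n * (p \<bullet> p)) + M a ((2 * s) *\<^sub>R p) = 0"
    using s by (simp add: bilinear_rmul[OF M(1)] distrib_left)
  moreover have "2 * ((p - q) \<bullet> p) = (norm p)\<^sup>2 - (norm q)\<^sup>2 + (norm (p - q))\<^sup>2"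
    by (simp add: power2_norm_eq_inner inner_diff inner_commute)
  \<comment> \<open>The damping term has the favourable sign; for \<open>n = 0\<close> the quotient
    is 0 by convention.\<close>
  moreover have "\<alpha> / real n * (p \<bullet> p) \<ge> 0"
    using \<alpha> by simp
  ultimately have "G_M M a b + (norm p)\<^sup>2 \<le> G_M M b c + (norm q)\<^sup>2"
    using M(3)[of "a - 2 *\<^sub>R b + c"] zero_le_power2[of "norm (p - q)"]
    unfolding p G_M_identity[OF M(1,2)] by linarith
  then show ?thesis
    by (simp add: bdf2_energy_def a_def b_def c_def p_def q_def numeral_2_eq_2)
qed

text \<open>The run ends at the least stopping index from 3 on.\<close>

lemma terminates_at_exI:
  assumes "3 \<le> n" "stop n"
  shows "\<exists>n. terminates_at stop n"
  using exists_least_iff[of "\<lambda>n. 3 \<le> n \<and> stop n"] assms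
  unfolding terminates_at_def by (metis atLeastLessThan_iff)

text \<open>After \<open>k\<close> steps the loss is at least \<open>k * \<delta>\<close>, which
  exceeds \<open>E m\<close> for large \<open>k\<close> by the Archimedean property.\<close>

lemma nonneg_uniform_decrease_False:
  fixes E :: "nat \<Rightarrow> real"
  assumes "\<And>n. 0 \<le> E n" "\<delta> > 0" "\<And>n. n \<ge> m \<Longrightarrow> E (Suc n) \<le> E n - \<delta>"
  shows False
proof -
  have bound: "E (m + k) \<le> E m - real k * \<delta>" for k
  proof (induction k)
    case (Suc k)
    with assms(3)[of "m + k"] show ?case
      by (simp add: algebra_simps)
  qed simp
  obtain k where "E m < real k * \<delta>"
    using reals_Archimedean3[OF assms(2)] by blast
  with bound[of k] assms(1)[of "m + k"] show False
    by linarith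
qed

lemma bdf2_run_energy_stop_terminates:
  assumes M: "bilinear M" "\<And>v w. M v w = M w v" "\<And>v. M v v \<ge> 0"
    and s: "s > 0" and \<alpha>: "\<alpha> \<ge> 0" and \<epsilon>: "\<epsilon> > 0"
    and run: "bdf2_run (energy_stop M s \<epsilon> u du) A F M \<alpha> s u du"
  shows "\<exists>n. terminates_at (energy_stop M s \<epsilon> u du) n"
proof (rule ccontr)
  assume "\<nexists>n. terminates_at (energy_stop M s \<epsilon> u du) n"
  then have nostop: "\<not> energy_stop M s \<epsilon> u du n" if "n \<ge> 3" for n
    using terminates_at_exI that by blast
  \<comment> \<open>A run that never stops must produce all iterates.\<close>
  then have "bdf2_iterates A F M \<alpha> s u du N" for N
    using run by (simp add: bdf2_run_def)
  then have step: "bdf2_step F M \<alpha> s u du n" if "n \<ge> 3" for n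
    using that by (meson atLeastAtMost_iff bdf2_iterates_def order_refl)
  let ?E = "bdf2_energy M u du"
  show False
  \<comment> \<open>The start is 2 because step 3 is the first to be checked, and it compares the
    energies at 3 and 2.\<close>
  proof (rule nonneg_uniform_decrease_False[of ?E "2 * s * \<epsilon>" 2])
    fix n :: nat
    show "0 \<le> ?E n"
      using G_M_nonneg[OF M] by (simp add: bdf2_energy_def)
    assume n: "2 \<le> n"
    have "?E (Suc n) \<le> ?E n"
      using bdf2_step_energy_decay[OF M s \<alpha> step[of "Suc n"]] n by simp
    moreover have "\<bar>1 / 2 * ((?E (Suc n) - ?E n) / s)\<bar> > \<epsilon>"
      using nostop[of "Suc n"] n by (simp add: energy_stop_def d_t_def inverse_eq_divide)
    then have "\<bar>?E (Suc n) - ?E n\<bar> > 2 * s * \<epsilon>"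
      using s by (simp add: abs_mult field_simps)
    \<comment> \<open>Decay fixes the sign inside the absolute value, so the failed test is a
      genuine drop.\<close>
    ultimately show "?E (Suc n) \<le> ?E n - 2 * s * \<epsilon>"
      by linarith
  qed (use s \<epsilon> in simp)
qed

theorem theorem4p4:
  fixes \<Omega> \<Gamma>\<^sub>D :: "(real^'d) set"
    and \<iota> :: "'u::{real_inner,complete_space} \<Rightarrow> real^'d \<Rightarrow> real^'m"
    and D :: "'u \<Rightarrow> real^'d \<Rightarrow> 'b::euclidean_space"
    and g :: "real^'d \<Rightarrow> 'b"
    and U\<^sub>D U\<^sub>0 :: "'u set"
    and \<zeta> :: "'z::real_normed_vector \<Rightarrow> real^'d \<Rightarrow> 'e::euclidean_space"
    and B :: "'u \<Rightarrow> 'u \<Rightarrow> 'z"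
    and u\<^sub>c :: 'z
    and M :: "'u \<Rightarrow> 'u \<Rightarrow> real"
    and c\<^sub>Z C\<^sub>1 C\<^sub>2 \<alpha> s :: real
    and \<A> :: "'u set"
    and \<F> :: "'u \<Rightarrow> 'u set"
    and u du :: "nat \<Rightarrow> 'u"
  assumes domain: "bounded_lipschitz_domain \<Omega>"
    and U_functions: "function_space_on \<Omega> \<iota>"
    and U_embedded: "continuously_embedded_H1 \<Omega> \<iota>"
    and Gamma_D: "\<Gamma>\<^sub>D \<subseteq> frontier \<Omega>"
    and D_linear: "linear_ae \<Omega> D"
    and D_L2: "\<And>v. L2 \<Omega> (D v)"
    and U_D: "U\<^sub>D = dirichlet_set \<Omega> \<Gamma>\<^sub>D D g"
    and U_0: "U\<^sub>0 = dirichlet_set \<Omega> \<Gamma>\<^sub>D D (\<lambda>x. 0)"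
    and Z_functions: "function_space_on \<Omega> \<zeta>"
    and B_bilinear: "bilinear B"
    and B_sym: "\<And>v w. B v w = B w v"
    and B_bound: "\<And>v. norm (B v v) \<le> c\<^sub>Z * (norm v)\<^sup>2"
    and M_bilinear: "bilinear M"
    and M_sym: "\<And>v w. M v w = M w v"
    and C1: "C\<^sub>1 > 0"
    and M_coercive: "\<And>v. M v v \<ge> C\<^sub>1 * (norm v)\<^sup>2"
    and C2: "C\<^sub>2 > 0"
    and M_bounded: "\<And>v w. M v w \<le> C\<^sub>2 * norm v * norm w"
    and A: "\<A> = admissible_set \<Omega> \<zeta> B u\<^sub>c U\<^sub>D"
    and F: "\<F> = tangent_space \<Omega> \<zeta> B U\<^sub>0"
    and s: "s > 0"
    and alpha: "\<alpha> \<ge> 3"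
  shows
    "(\<forall>N. bdf2_iterates \<A> \<F> M \<alpha> s u du N \<longrightarrow>
        (\<forall>n\<in>{3..N}.
           G_M M (u n) (u (n - 1)) + (norm (du n))\<^sup>2
             \<le> G_M M (u (n - 1)) (u (n - 2)) + (norm (du (n - 1)))\<^sup>2)) \<and>
     (\<forall>\<epsilon>>0.
        (\<forall>T_max>0. bdf2_run (bdf2_stop M s \<epsilon> T_max u du) \<A> \<F> M \<alpha> s u du \<longrightarrow>
           (\<exists>n. terminates_at (bdf2_stop M s \<epsilon> T_max u du) n)) \<and>
        (bdf2_run (energy_stop M s \<epsilon> u du) \<A> \<F> M \<alpha> s u du \<longrightarrow>
           (\<exists>n. terminates_at (energy_stop M s \<epsilon> u du) n)))"
proof -
  have M: "bilinear M" "\<And>v w. M v w = M w v" "\<And>v. M v v \<ge> 0"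
  proof -
    show "M v v \<ge> 0" for v
      using M_coercive[of v] C1 by (smt (verit) mult_nonneg_nonneg zero_le_power2)
  qed (fact M_bilinear M_sym)+
  have \<alpha>: "\<alpha> \<ge> 0"
    using alpha by simp
  show ?thesis
  proof (intro conjI allI impI ballI)
    fix N n
    assume "bdf2_iterates \<A> \<F> M \<alpha> s u du N" "n \<in> {3..N}"
    then have "bdf2_step \<F> M \<alpha> s u du n"
      by (simp add: bdf2_iterates_def)
    from bdf2_step_energy_decay[OF M s \<alpha> this]
    show "G_M M (u n) (u (n - 1)) + (norm (du n))\<^sup>2
        \<le> G_M M (u (n - 1)) (u (n - 2)) + (norm (du (n - 1)))\<^sup>2"
      by (simp add: bdf2_energy_def numeral_2_eq_2)
  next
    fix \<epsilon> T_max :: real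
    \<comment> \<open>Here the cap suffices: the first index beyond \<open>T_max / s\<close>, raised
      to 3, where checking begins.\<close>
    let ?n = "max 3 (nat (\<lfloor>T_max / s\<rfloor> + 1))"
    have "bdf2_stop M s \<epsilon> T_max u du ?n"
      unfolding bdf2_stop_def by linarith
    then show "\<exists>n. terminates_at (bdf2_stop M s \<epsilon> T_max u du) n"
      by (rule terminates_at_exI[rotated]) simp
  next
    \<comment> \<open>Without the cap, termination rests on the energy argument.\<close>
    fix \<epsilon> :: real
    assume "\<epsilon> > 0" "bdf2_run (energy_stop M s \<epsilon> u du) \<A> \<F> M \<alpha> s u du"
    then show "\<exists>n. terminates_at (energy_stop M s \<epsilon> u du) n"
      by (rule bdf2_run_energy_stop_terminates[OF M s \<alpha>])
  qed
qed

end
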